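(* Let $\alpha>0$ be arbitrary. Then there exist a Lipschitz continuous function $f\colon\mathbb{R}^2\to\mathbb{R}$ and an absolutely continuous curve $\gamma\colon[0,+\infty)\to\mathbb{R}^2$ such that $$-\dot\gamma(t)\in\partial f(\gamma(t))\ \text{ for a.e. } t\in[0,+\infty),\qquad \gamma(0)\notin\mathrm{Crit}(f),$$ and $$f(\gamma(t))-f(\gamma(0))\ \ge\ \alpha\,t\qquad\text{for every } t\in[0,+\infty).$$
   Context: For a (locally) Lipschitz function $f\colon\mathcal{U}\to\mathbb{R}$ on an open set $\mathcal{U}\subset\mathbb{R}^d$, let $\mathcal{D}_f\subset\mathcal{U}$ be the set of points where $f$ is differentiable (it has full Lebesgue measure in $\mathcal{U}$ by Rademacher's theorem). The Clarke subdifferential of $f$ at $x\in\mathcal{U}$ is $$\partial f(x):=\mathrm{conv}\Big\{\lim_{k\to\infty}\nabla f(x_k):\ x_k\to x,\ \{x_k\}\subset\mathcal{D}_f\Big\},$$ where only sequences for which the limit exists are considered and $\mathrm{conv}$ denotes the convex hull. A point $x$ is (Clarke) critical for $f$ if $0\in\partial f(x)$; $\mathrm{Crit}(f)$ denotes the set of all critical points of $f$. *)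

theory Defs
  imports "HOL-Analysis.Analysis"
begin

text \<open>Limits of gradients of \<open>f\<close> along sequences of differentiability points in \<open>U\<close> that tend
  to \<open>x\<close>. In a Euclidean space every differentiable real-valued function has a (unique) gradient, so
  \<open>GDERIV f (y k) :> g k\<close> says that \<open>f\<close> is differentiable at \<open>y k\<close> and \<open>g k\<close> is its gradient there.
  The set \<open>U\<close> is meant to be open, so that differentiability on \<open>U\<close> and in the ambient space agree.\<close>

definition limiting_gradients ::
  "'a::euclidean_space set \<Rightarrow> ('a \<Rightarrow> real) \<Rightarrow> 'a \<Rightarrow> 'a set" where
  "limiting_gradients U f x =
    {v. \<exists>y g. (\<forall>k::nat. y k \<in> U \<and> GDERIV f (y k) :> g k) \<and> y \<longlonglongrightarrow> x \<and> g \<longlonglongrightarrow> v}"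

definition clarke_subdifferential ::
  "'a::euclidean_space set \<Rightarrow> ('a \<Rightarrow> real) \<Rightarrow> 'a \<Rightarrow> 'a set" where
  "clarke_subdifferential U f x = convex hull (limiting_gradients U f x)"

definition Crit :: "'a::euclidean_space set \<Rightarrow> ('a \<Rightarrow> real) \<Rightarrow> 'a set" where
  "Crit U f = {x \<in> U. 0 \<in> clarke_subdifferential U f x}"

text \<open>Absolute continuity of a curve on an interval \<open>I\<close>, possibly unbounded: one \<open>\<delta>\<close> serves all
  finite families of non-overlapping subintervals of \<open>I\<close>. On an unbounded interval this implies
  absolute continuity on each compact subinterval.\<close>

definition absolutely_continuous_curve ::
  "real set \<Rightarrow> (real \<Rightarrow> 'a::real_normed_vector) \<Rightarrow> bool" where
  "absolutely_continuous_curve I \<gamma> \<longleftrightarrow>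
    (\<forall>\<epsilon>>0. \<exists>\<delta>>0. \<forall>(n::nat) a b.
      (\<forall>i<n. a i \<le> b i \<and> {a i..b i} \<subseteq> I) \<longrightarrow>
      disjoint_family_on (\<lambda>i. {a i<..<b i}) {..<n} \<longrightarrow>
      (\<Sum>i<n. b i - a i) < \<delta> \<longrightarrow>
      (\<Sum>i<n. norm (\<gamma> (b i) - \<gamma> (a i))) < \<epsilon>)"

end

theory Submission
  imports Defs
begin

text \<open>Take \<open>g\<close> on the line with slope \<open>-1\<close> on a dense open subset \<open>S\<close> of the half-line and a large
  slope elsewhere, where \<open>S\<close> fills only a small fraction of each interval \<open>[0, t]\<close>. Then \<open>g\<close> grows
  at a fast linear rate, although \<open>-1\<close> is a limit of derivatives at every point. With
  \<open>f (x, y) = g x + y\<close> and \<open>\<gamma> t = (t, -t)\<close>, the vector \<open>(-1, 1) = - \<gamma>' t\<close> is always a Clarke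
  subgradient, \<open>f\<close> has no critical point as all its subgradients have second component \<open>1\<close>, and
  \<open>f (\<gamma> t) = g t - t\<close>.\<close>

lemma lipschitz_on_imp_absolutely_continuous_curve:
  assumes "L-lipschitz_on I \<gamma>"
  shows "absolutely_continuous_curve I \<gamma>"
  unfolding absolutely_continuous_curve_def
proof (intro allI impI)
  fix \<epsilon> :: real
  assume "\<epsilon> > 0"
  have L: "L \<ge> 0" using assms by (rule lipschitz_on_nonneg)
  show "\<exists>\<delta>>0. \<forall>(n::nat) a b. (\<forall>i<n. a i \<le> b i \<and> {a i..b i} \<subseteq> I) \<longrightarrow>
      disjoint_family_on (\<lambda>i. {a i<..<b i}) {..<n} \<longrightarrow>
      (\<Sum>i<n. b i - a i) < \<delta> \<longrightarrow> (\<Sum>i<n. norm (\<gamma> (b i) - \<gamma> (a i))) < \<epsilon>"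
  \<comment> \<open>Dividing by \<open>L + 1\<close> rather than \<open>L\<close> also covers
    constant curves, where \<open>L\<close> may be 0.\<close>
  proof (intro exI[of _ "\<epsilon> / (L + 1)"] conjI allI impI)
    show "\<epsilon> / (L + 1) > 0" using \<open>\<epsilon> > 0\<close> L by simp
    fix n :: nat and a b :: "nat \<Rightarrow> real"
    assume ab: "\<forall>i<n. a i \<le> b i \<and> {a i..b i} \<subseteq> I"
      and len: "(\<Sum>i<n. b i - a i) < \<epsilon> / (L + 1)"
    have "(\<Sum>i<n. norm (\<gamma> (b i) - \<gamma> (a i))) \<le> (\<Sum>i<n. L * (b i - a i))"
    proof (rule sum_mono)
      fix i assume "i \<in> {..<n}"
      with ab have "a i \<le> b i" "{a i..b i} \<subseteq> I" by auto
      then have "a i \<le> b i" "a i \<in> I" "b i \<in> I" by auto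
      then show "norm (\<gamma> (b i) - \<gamma> (a i)) \<le> L * (b i - a i)"
        using lipschitz_onD[OF assms, of "b i" "a i"] by (simp add: dist_norm)
    qed
    also have "\<dots> = L * (\<Sum>i<n. b i - a i)" by (simp add: sum_distrib_left)
    also have "\<dots> \<le> (L + 1) * (\<Sum>i<n. b i - a i)"
      using ab by (intro mult_right_mono sum_nonneg) auto
    also have "\<dots> < \<epsilon>" using len L by (simp add: field_simps)
    finally show "(\<Sum>i<n. norm (\<gamma> (b i) - \<gamma> (a i))) < \<epsilon>" .
  qed
qed

text \<open>Each positive rational is the left end point of an open interval whose length is a
  summable weight times \<open>c\<close> times that rational. Fixed lengths, however small their
  sum, would not do: the bound has to shrink with \<open>t\<close> down to \<open>t = 0\<close>, and
  scaling by the left end point achieves this.\<close>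

lemma exists_thin_dense_open_set:
  fixes c :: real
  assumes "c > 0"
  obtains S :: "real set" where "open S" "S \<subseteq> {0<..}" "{0..} \<subseteq> closure S"
    "\<forall>t\<ge>0. measure lborel (S \<inter> {0..t}) \<le> c * t"
proof -
  define Q :: "real set" where "Q = \<rat> \<inter> {0<..}"
  define q where "q = from_nat_into Q"
  have "1 \<in> Q" by (simp add: Q_def)
  moreover have "countable Q" unfolding Q_def using countable_rat by blast
  ultimately have rq: "range q = Q" unfolding q_def by (intro range_from_nat_into) auto
  then have qpos: "q n > 0" for n unfolding Q_def by (metis Int_iff greaterThan_iff rangeI)
  define J where "J n = {q n<..<q n + c * q n * (1/2)^Suc n}" for n
  define S where "S = (\<Union>n. J n)"
  have J_dense: "\<exists>u\<in>S. \<bar>u - x\<bar> < e" if x: "x \<ge> 0" and e: "e > 0" for x e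
  proof -
    \<comment> \<open>The rational is taken strictly to the right of \<open>x\<close>, so it is
      positive even when \<open>x = 0\<close>.\<close>
    obtain r where r: "r \<in> \<rat>" "x < r" "r < x + e / 2"
      using Rats_dense_in_real[of x "x + e / 2"] e by auto
    then have "r \<in> Q" using x by (simp add: Q_def)
    then obtain n where n: "r = q n" using rq by blast
    define d where "d = c * q n * (1/2)^Suc n"
    have d: "d > 0" unfolding d_def using qpos[of n] assms by simp
    define u where "u = r + min (d / 2) (e / 2)"
    have "u \<in> J n" unfolding J_def d_def[symmetric] u_def n using d e by (auto simp: min_def)
    then have "u \<in> S" unfolding S_def by blast
    moreover have "\<bar>u - x\<bar> < e" using r d e unfolding u_def by (auto simp: min_def)
    ultimately show ?thesis by blast
  qed
  show thesis
  proof (rule that)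
    show "open S" unfolding S_def J_def by auto
    show "S \<subseteq> {0<..}" unfolding S_def J_def using qpos by (force intro: less_trans)
    show "{0..} \<subseteq> closure S"
      using J_dense by (auto simp: closure_approachable dist_real_def)
    show "\<forall>t\<ge>0. measure lborel (S \<inter> {0..t}) \<le> c * t"
    proof (intro allI impI)
      fix t :: real
      assume t: "t \<ge> 0"
      \<comment> \<open>An interval of \<open>S\<close> that meets \<open>[0, t]\<close> starts before \<open>t\<close>; its length, proportional to its
        left end point, is then at most a multiple of \<open>t\<close>.\<close>
      have le: "emeasure lborel (J n \<inter> {0..t}) \<le> ennreal (c * t * (1/2)^Suc n)" for n
      proof (cases "q n < t")
        case True
        have "emeasure lborel (J n \<inter> {0..t}) \<le> emeasure lborel (J n)"
          by (rule emeasure_mono) (auto simp: J_def)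
        also have "\<dots> = ennreal (c * q n * (1/2)^Suc n)"
          unfolding J_def using qpos[of n] assms by (subst emeasure_lborel_Ioo) auto
        also have "\<dots> \<le> ennreal (c * t * (1/2)^Suc n)"
          using True assms by (intro ennreal_leI mult_right_mono mult_left_mono) auto
        finally show ?thesis .
      next
        case False
        then have "J n \<inter> {0..t} = {}" by (auto simp: J_def)
        then show ?thesis by simp
      qed
      have "emeasure lborel (S \<inter> {0..t}) = emeasure lborel (\<Union>n. J n \<inter> {0..t})"
        by (simp add: S_def)
      also have "\<dots> \<le> (\<Sum>n. emeasure lborel (J n \<inter> {0..t}))"
        by (rule emeasure_subadditive_countably) (auto simp: J_def)
      also have "\<dots> \<le> (\<Sum>n. ennreal (c * t * (1/2)^Suc n))"
        by (intro suminf_le le) auto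
      also have "\<dots> = ennreal (c * t)"
        using sums_mult[OF power_half_series, of "c * t"] t assms
        by (intro suminf_ennreal_eq) auto
      finally show "measure lborel (S \<inter> {0..t}) \<le> c * t"
        unfolding measure_def using t assms by (simp add: enn2real_leI)
    qed
  qed
qed

text \<open>The function is the primitive, vanishing at 0, of the function equal to -1 on a thin
  dense open set and to a large constant \<open>b\<close> elsewhere. It is written through the
  measure \<open>m\<close> of the part of that set below \<open>x\<close>.\<close>

lemma exists_fast_growing_with_limiting_derivative_minus_one:
  fixes a :: real
  assumes "a > 0"
  obtains g :: "real \<Rightarrow> real" and L :: real and S :: "real set"
  where "L-lipschitz_on UNIV g" "g 0 = 0" "\<forall>t\<ge>0. g t \<ge> a * t"
    "{0..} \<subseteq> closure S" "\<forall>u\<in>S. (g has_real_derivative -1) (at u)"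
proof -
  obtain S :: "real set" where S: "open S" "S \<subseteq> {0<..}" "{0..} \<subseteq> closure S"
    and thin: "\<forall>t\<ge>0. measure lborel (S \<inter> {0..t}) \<le> 1/2 * t"
    by (rule exists_thin_dense_open_set[OF half_gt_zero[OF zero_less_one]])
  define m where "m x = measure lborel (S \<inter> {0..x})" for x
  \<comment> \<open>Since \<open>m t\<close> is at most \<open>t / 2\<close>, the growth rate of
    \<open>g\<close> is at least \<open>b - (b + 1) / 2 = (b - 1) / 2\<close>, and this equals
    \<open>a\<close>.\<close>
  define b where "b = 2 * a + 1"
  define g where "g x = b * x - (b + 1) * m x" for x
  have Sb: "S \<in> sets borel" using S(1) by auto
  \<comment> \<open>Negative arguments need no separate case: \<open>S\<close> has only positive
    points, so \<open>m\<close> vanishes there and the decomposition of \<open>S\<close> below still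
    holds.\<close>
  have m_diff: "m y - m x = measure lborel (S \<inter> {x<..y})" if "x \<le> y" for x y
  proof -
    have "S \<inter> {0..y} = (S \<inter> {0..x}) \<union> (S \<inter> {x<..y})" using S(2) that by force
    \<comment> \<open>Finiteness is what lets additivity pass from \<open>emeasure\<close> to the
      real-valued \<open>measure\<close>.\<close>
    moreover have "emeasure lborel (S \<inter> {u..v}) < \<infinity>" for u v
      by (rule le_less_trans[OF emeasure_mono[of _ "{u..v}"]]) (auto simp: emeasure_lborel_Icc_eq)
    moreover have "emeasure lborel (S \<inter> {x<..y}) < \<infinity>"
      by (rule le_less_trans[OF emeasure_mono[of _ "{x..y}"]]) (auto simp: emeasure_lborel_Icc_eq)
    ultimately have "m y = m x + measure lborel (S \<inter> {x<..y})"
      unfolding m_def using Sb by (simp add: less_top, subst measure_Union) (auto simp: less_top)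
    then show ?thesis by simp
  qed
  have m_lip: "0 \<le> m y - m x" "m y - m x \<le> y - x" if "x \<le> y" for x y
  proof -
    show "0 \<le> m y - m x" using m_diff[OF that] by simp
    have "measure lborel (S \<inter> {x<..y}) \<le> measure lborel {x<..y}"
      using Sb that by (intro measure_mono_fmeasurable) (auto simp: fmeasurable_def)
    then show "m y - m x \<le> y - x" using m_diff[OF that] that by simp
  qed
  have g_lip: "\<bar>g x - g y\<bar> \<le> (2 * b + 1) * \<bar>x - y\<bar>" for x y
  proof -
    have b: "b > 0" using assms by (simp add: b_def)
    have m: "\<bar>m x - m y\<bar> \<le> \<bar>x - y\<bar>" using m_lip[of x y] m_lip[of y x] by linarith
    have "\<bar>g x - g y\<bar> = \<bar>b * (x - y) - (b + 1) * (m x - m y)\<bar>"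
      by (simp add: g_def algebra_simps)
    also have "\<dots> \<le> b * \<bar>x - y\<bar> + (b + 1) * \<bar>m x - m y\<bar>"
      using abs_triangle_ineq4[of "b * (x - y)" "(b + 1) * (m x - m y)"] b
      by (simp add: abs_mult)
    also have "\<dots> \<le> b * \<bar>x - y\<bar> + (b + 1) * \<bar>x - y\<bar>"
      using m b by (intro add_left_mono mult_left_mono) auto
    finally show ?thesis by (simp add: algebra_simps)
  qed
  have m0: "m 0 = 0" using S(2) unfolding m_def by (subgoal_tac "S \<inter> {0..0} = {}") auto
  show thesis
  proof (rule that)
    show "(2 * b + 1)-lipschitz_on UNIV g"
      using g_lip assms by (intro lipschitz_onI) (auto simp: dist_real_def b_def)
    show "g 0 = 0" by (simp add: g_def m0)
    show "{0..} \<subseteq> closure S" by (rule S(3))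
    show "\<forall>t\<ge>0. g t \<ge> a * t"
    proof (intro allI impI)
      fix t :: real
      assume "t \<ge> 0"
      then have "(b + 1) * m t \<le> (b + 1) * (1/2 * t)"
        using thin assms unfolding m_def b_def by (intro mult_left_mono) auto
      then show "g t \<ge> a * t" by (simp add: g_def b_def algebra_simps)
    qed
    show "\<forall>u\<in>S. (g has_real_derivative -1) (at u)"
    proof
      fix u
      assume "u \<in> S"
      then obtain e where e: "e > 0" "cball u e \<subseteq> S"
        using S(1) open_contains_cball by blast
      \<comment> \<open>Inside a ball contained in \<open>S\<close>, \<open>m\<close> has slope 1,
        so \<open>g\<close> has slope \<open>b - (b + 1) = -1\<close>.\<close>
      have m_eq: "m y - m x = y - x" if "x \<le> y" "x \<in> cball u e" "y \<in> cball u e" for x y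
      proof -
        have "{x<..y} \<subseteq> cball u e" using that by (auto simp: dist_real_def)
        then have "S \<inter> {x<..y} = {x<..y}" using e(2) by blast
        then show ?thesis using m_diff[OF that(1)] that(1) by simp
      qed
      have g_eq: "g x = g u - (x - u)" if "x \<in> ball u e" for x
      proof -
        have "m x - m u = x - u"
          using m_eq[of x u] m_eq[of u x] that e(1) by (cases "x \<le> u") auto
        then have "m x = m u + (x - u)" by simp
        then show ?thesis unfolding g_def by (simp only:) (simp add: algebra_simps)
      qed
      have centre: "u \<in> ball u e" using e(1) by simp
      have "((\<lambda>x. g u - (x - u)) has_real_derivative -1) (at u)"
        by (auto intro!: derivative_eq_intros)
      then show "(g has_real_derivative -1) (at u)"
        by (rule has_field_derivative_transform_within_open[OF _ open_ball centre g_eq[symmetric]])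
    qed
  qed
qed

lemma GDERIV_fst_plus_snd:
  fixes z :: "real ^ 2"
  assumes "(g has_real_derivative d) (at (z $ 1))"
  shows "GDERIV (\<lambda>z. g (z $ 1) + z $ 2) z :> vector [d, 1]"
proof -
  have "((\<lambda>z :: real ^ 2. z $ 1) has_derivative (\<lambda>h. h $ 1)) (at z)"
    and 2: "((\<lambda>z :: real ^ 2. z $ 2) has_derivative (\<lambda>h. h $ 2)) (at z)"
    by (intro bounded_linear_imp_has_derivative bounded_linear_vec_nth)+
  then have "((\<lambda>z. g (z $ 1)) has_derivative (\<lambda>h. d * h $ 1)) (at z)"
    using assms unfolding has_field_derivative_def
    by (auto dest: has_derivative_compose)
  then have "((\<lambda>z. g (z $ 1) + z $ 2) has_derivative (\<lambda>h. d * h $ 1 + h $ 2)) (at z)"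
    using 2 by (rule has_derivative_add)
  then show ?thesis
    unfolding gderiv_def by (simp add: inner_vec_def sum_2 mult.commute)
qed

text \<open>Restricted to the vertical line through \<open>z\<close>, the \<open>g\<close> term is
  constant and the function has slope 1. This argument asks for no differentiability of
  \<open>g\<close>, so it applies to every gradient that exists.\<close>

lemma GDERIV_fst_plus_snd_component:
  fixes z G :: "real ^ 2"
  assumes "GDERIV (\<lambda>z. g (z $ 1) + z $ 2) z :> G"
  shows "G $ 2 = 1"
proof -
  define \<phi> where "\<phi> s = z + s *\<^sub>R axis 2 (1 :: real)" for s
  have "(\<phi> has_derivative (\<lambda>s. s *\<^sub>R axis 2 1)) (at 0)"
    unfolding \<phi>_def by (auto intro!: derivative_eq_intros)
  moreover have "((\<lambda>z. g (z $ 1) + z $ 2) has_derivative (\<lambda>h. inner h G)) (at (\<phi> 0))"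
    using assms by (simp add: gderiv_def \<phi>_def)
  ultimately have "((\<lambda>s. g (\<phi> s $ 1) + \<phi> s $ 2) has_derivative
      (\<lambda>s. inner (s *\<^sub>R axis 2 1) G)) (at 0)"
    by (rule has_derivative_compose)
  moreover have "(\<lambda>s. g (\<phi> s $ 1) + \<phi> s $ 2) = (\<lambda>s. (g (z $ 1) + z $ 2) + s)"
    by (simp add: \<phi>_def axis_def fun_eq_iff)
  ultimately have "((\<lambda>s. (g (z $ 1) + z $ 2) + s) has_derivative
      (\<lambda>s. inner (s *\<^sub>R axis 2 1) G)) (at 0)"
    by (simp only:)
  moreover have "((\<lambda>s. (g (z $ 1) + z $ 2) + s) has_derivative (\<lambda>s. s)) (at 0)"
    using has_derivative_add[OF has_derivative_const has_derivative_ident] by simp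
  ultimately have "(\<lambda>s. inner (s *\<^sub>R axis 2 1) G) = (\<lambda>s. s)"
    by (rule has_derivative_unique)
  from fun_cong[OF this, of 1] show ?thesis by (simp add: inner_axis')
qed

text \<open>The line of vectors with second component 1 is closed and convex and misses 0. It
  contains all gradients, hence also their limits and the convex hull of these.\<close>

lemma Crit_fst_plus_snd: "Crit U (\<lambda>z :: real ^ 2. g (z $ 1) + z $ 2) = {}"
proof -
  let ?f = "\<lambda>z :: real ^ 2. g (z $ 1) + z $ 2"
  have "v $ 2 = 1" if v: "v \<in> limiting_gradients U ?f x" for v x
  proof -
    obtain y G where *: "\<And>k. GDERIV ?f (y k) :> G k" and lim: "G \<longlonglongrightarrow> v"
      using v unfolding limiting_gradients_def by blast
    have "(\<lambda>k. G k $ 2) \<longlonglongrightarrow> v $ 2" using lim by (rule tendsto_vec_nth)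
    moreover have "G k $ 2 = 1" for k using * by (rule GDERIV_fst_plus_snd_component)
    ultimately show ?thesis by (simp add: LIMSEQ_const_iff)
  qed
  then have "clarke_subdifferential U ?f x \<subseteq> {v. v $ 2 = 1}" for x
    unfolding clarke_subdifferential_def
    by (intro hull_minimal) (auto simp: convex_alt algebra_simps)
  then have "0 \<notin> clarke_subdifferential U ?f x" for x
    by (metis (mono_tags, lifting) mem_Collect_eq subsetD zero_index zero_neq_one)
  then show ?thesis unfolding Crit_def by blast
qed

theorem proposition3:
  fixes \<alpha> :: real
  assumes "\<alpha> > 0"
  shows "\<exists>(f :: real ^ 2 \<Rightarrow> real) (\<gamma> :: real \<Rightarrow> real ^ 2).
    (\<exists>L. L-lipschitz_on UNIV f) \<and>
    absolutely_continuous_curve {0..} \<gamma> \<and>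
    (AE t in lebesgue_on {0..}. \<exists>v. (\<gamma> has_vector_derivative v) (at t within {0..}) \<and>
        - v \<in> clarke_subdifferential UNIV f (\<gamma> t)) \<and>
    \<gamma> 0 \<notin> Crit UNIV f \<and>
    (\<forall>t\<ge>0. f (\<gamma> t) - f (\<gamma> 0) \<ge> \<alpha> * t)"
proof -
  \<comment> \<open>The extra 1 pays for the second coordinate, which contributes \<open>- t\<close>
    to \<open>f\<close> along the curve.\<close>
  have pos: "\<alpha> + 1 > 0" using assms by simp
  obtain g :: "real \<Rightarrow> real" and L S where gL: "L-lipschitz_on UNIV g" and g0: "g 0 = 0"
    and growth: "\<forall>t\<ge>0. g t \<ge> (\<alpha> + 1) * t"
    and dense: "{0..} \<subseteq> closure S"
    and deriv: "\<forall>u\<in>S. (g has_real_derivative -1) (at u)"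
    by (rule exists_fast_growing_with_limiting_derivative_minus_one[OF pos])
  define f where "f = (\<lambda>z :: real ^ 2. g (z $ 1) + z $ 2)"
  define w :: "real ^ 2" where "w = vector [1, -1]"
  define \<gamma> where "\<gamma> t = t *\<^sub>R w" for t
  have "(L + 1)-lipschitz_on UNIV f"
  proof (rule lipschitz_onI)
    fix x y :: "real ^ 2"
    have "\<bar>f x - f y\<bar> \<le> \<bar>g (x $ 1) - g (y $ 1)\<bar> + \<bar>(x - y) $ 2\<bar>" by (simp add: f_def)
    also have "\<dots> \<le> L * \<bar>(x - y) $ 1\<bar> + \<bar>(x - y) $ 2\<bar>"
      using lipschitz_onD[OF gL, of "x $ 1" "y $ 1"] by (simp add: dist_real_def)
    also have "\<dots> \<le> L * norm (x - y) + norm (x - y)"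
      by (intro add_mono mult_left_mono component_le_norm_cart lipschitz_on_nonneg[OF gL])
    finally show "dist (f x) (f y) \<le> (L + 1) * dist x y"
      by (simp add: dist_real_def dist_norm algebra_simps)
  qed (use lipschitz_on_nonneg[OF gL] in simp)
  moreover have "(norm w)-lipschitz_on {0..} \<gamma>"
    by (rule lipschitz_onI)
      (auto simp: \<gamma>_def dist_norm mult.commute simp flip: scaleR_diff_left)
  then have "absolutely_continuous_curve {0..} \<gamma>"
    by (rule lipschitz_on_imp_absolutely_continuous_curve)
  \<comment> \<open>The inclusion is shown for every \<open>t \<ge> 0\<close>, not only almost
    everywhere; at \<open>t = 0\<close> the derivative is one-sided.\<close>
  moreover have "\<exists>v. (\<gamma> has_vector_derivative v) (at t within {0..}) \<and>
      - v \<in> clarke_subdifferential UNIV f (\<gamma> t)" if t: "t \<ge> 0" for t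
  proof (intro exI conjI)
    show "(\<gamma> has_vector_derivative w) (at t within {0..})"
      unfolding \<gamma>_def has_vector_derivative_def by (auto intro!: derivative_eq_intros)
    have "t \<in> closure S" using dense t by auto
    then obtain u where u: "\<forall>k. u k \<in> S" "u \<longlonglongrightarrow> t"
      unfolding closure_sequential by (elim exE conjE)
    \<comment> \<open>Only the first coordinate is moved, from \<open>t\<close> to the point
      \<open>u k\<close> of \<open>S\<close>. There the gradient of \<open>f\<close> is exactly
      \<open>- w\<close>, so the sequence of gradients is constant.\<close>
    define y where "y k = \<gamma> t + (u k - t) *\<^sub>R axis 1 (1 :: real)" for k
    have "y \<longlonglongrightarrow> \<gamma> t + (t - t) *\<^sub>R axis 1 1"
      unfolding y_def by (intro tendsto_intros u)
    moreover have w: "- w = vector [-1, 1]" by (simp add: w_def vec_eq_iff forall_2)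
    have "y k $ 1 = u k" for k by (simp add: y_def \<gamma>_def w_def)
    then have "GDERIV f (y k) :> - w" for k
      unfolding w f_def using deriv u(1) by (intro GDERIV_fst_plus_snd) simp
    ultimately have "- w \<in> limiting_gradients UNIV f (\<gamma> t)"
      unfolding limiting_gradients_def
      by (intro CollectI exI[of _ y] exI[of _ "\<lambda>_. - w"]) simp
    then show "- w \<in> clarke_subdifferential UNIV f (\<gamma> t)"
      unfolding clarke_subdifferential_def by (rule hull_inc)
  qed
  then have "AE t in lebesgue_on {0..}. \<exists>v. (\<gamma> has_vector_derivative v) (at t within {0..}) \<and>
      - v \<in> clarke_subdifferential UNIV f (\<gamma> t)"
    by (intro AE_I2) (simp add: space_restrict_space)
  moreover have "\<gamma> 0 \<notin> Crit UNIV f" unfolding f_def by (simp add: Crit_fst_plus_snd)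
  moreover have "f (\<gamma> t) - f (\<gamma> 0) \<ge> \<alpha> * t" if "t \<ge> 0" for t
    using growth[rule_format, OF that] by (simp add: f_def \<gamma>_def w_def g0 algebra_simps)
  ultimately show ?thesis
    by (intro exI[of _ f] exI[of _ \<gamma>] conjI exI[of _ "L + 1"] allI impI)
qed

end
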